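(* Consider a two-armed bandit in which arm $1$ (optimal) has deterministic reward $\mu^*$ and arm $2$ (suboptimal) has Gaussian reward $R_2\sim\mathcal{N}(\mu^*-\Delta,\sigma^2)$. Let the policy be $\pi(1)=1-\varepsilon$, $\pi(2)=\varepsilon$, and let the baseline be $b=V^\pi=\mu^*-\varepsilon\Delta$. Let $U_2=R_2-b$ be the advantage when arm $2$ is pulled and $\chi_2$ its delight. Then: \begin{enumerate} \item When $\sigma/\Delta\ll 1$: $\Pr(U_2>0\mid A=2)\le\exp\!\big(-\Omega(\Delta^2/\sigma^2)\big)$. \item When $\sigma/\Delta\gg 1$: $\Pr(U_2>0\mid A=2)=\Theta(1)$. \item Delight amplifies: $|\chi_2|=|U_2|\cdot\log(1/\varepsilon)$ grows as the policy avoids arm $2$. \end{enumerate}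
   Context: Here $\Delta>0$ is the gap between the mean rewards of the two arms, $\sigma>0$ is the reward noise of arm $2$, and $\varepsilon\in(0,1)$ is the probability that the policy pulls arm $2$, so "the policy avoids arm $2$" means $\varepsilon\to 0$. $A\in\{1,2\}$ is the arm pulled, drawn from $\pi$; conditionally on $A=2$ the reward is $R_2$. $V^\pi=\mathbb{E}_{A\sim\pi}[R]$ is the expected reward under the policy. Delight is the product of advantage (reward minus baseline) and surprisal (negative log-probability of the chosen arm), so $\chi_2=U_2\,\ell_2$ with $\ell_2=-\log\pi(2)=\log(1/\varepsilon)$. *)

theory Defs
  imports "HOL-Probability.Probability"
begin

datatype arm = Arm1 | Arm2

text \<open>Joint law of the pulled arm and the observed reward: the arm is drawn from the policy
  \<open>\<pi>\<close> and then, given the arm \<open>a\<close>, the reward is drawn from \<open>\<nu> a\<close>.\<close>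

definition bandit_law :: "(arm \<Rightarrow> real measure) \<Rightarrow> arm pmf \<Rightarrow> (arm \<times> real) measure" where
  "bandit_law \<nu> \<pi> =
     measure_pmf \<pi> \<bind> (\<lambda>a. distr (\<nu> a) (count_space UNIV \<Otimes>\<^sub>M borel) (\<lambda>r. (a, r)))"

definition policy_value :: "(arm \<Rightarrow> real measure) \<Rightarrow> arm pmf \<Rightarrow> real" where
  "policy_value \<nu> \<pi> = (\<integral>\<omega>. snd \<omega> \<partial>bandit_law \<nu> \<pi>)"

text \<open>The baseline is the value of the policy.\<close>

definition advantage :: "(arm \<Rightarrow> real measure) \<Rightarrow> arm pmf \<Rightarrow> real \<Rightarrow> real" where
  "advantage \<nu> \<pi> r = r - policy_value \<nu> \<pi>"

definition surprisal :: "arm pmf \<Rightarrow> arm \<Rightarrow> real" where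
  "surprisal \<pi> a = - ln (pmf \<pi> a)"

text \<open>Delight of pulling arm \<open>a\<close> with advantage \<open>u\<close>.\<close>

definition delight :: "arm pmf \<Rightarrow> arm \<Rightarrow> real \<Rightarrow> real" where
  "delight \<pi> a u = u * surprisal \<pi> a"

fun gaussian_arms :: "real \<Rightarrow> real \<Rightarrow> real \<Rightarrow> arm \<Rightarrow> real measure" where
  "gaussian_arms \<mu> \<Delta> \<sigma> Arm1 = return borel \<mu>"
| "gaussian_arms \<mu> \<Delta> \<sigma> Arm2 = density lborel (normal_density (\<mu> - \<Delta>) \<sigma>)"

text \<open>Only meant for \<open>0 \<le> \<epsilon> \<le> 1\<close>: then arm 2 is pulled with probability \<open>\<epsilon>\<close>.\<close>

definition eps_policy :: "real \<Rightarrow> arm pmf" where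
  "eps_policy \<epsilon> = map_pmf (\<lambda>b. if b then Arm2 else Arm1) (bernoulli_pmf \<epsilon>)"

abbreviation U2 :: "real \<Rightarrow> real \<Rightarrow> real \<Rightarrow> real \<Rightarrow> real \<Rightarrow> real" where
  "U2 \<mu> \<Delta> \<sigma> \<epsilon> r \<equiv> advantage (gaussian_arms \<mu> \<Delta> \<sigma>) (eps_policy \<epsilon>) r"

abbreviation chi2 :: "real \<Rightarrow> real \<Rightarrow> real \<Rightarrow> real \<Rightarrow> real \<Rightarrow> real" where
  "chi2 \<mu> \<Delta> \<sigma> \<epsilon> r \<equiv> delight (eps_policy \<epsilon>) Arm2 (U2 \<mu> \<Delta> \<sigma> \<epsilon> r)"

definition prob_pos_advantage :: "real \<Rightarrow> real \<Rightarrow> real \<Rightarrow> real \<Rightarrow> real" where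
  "prob_pos_advantage \<mu> \<Delta> \<sigma> \<epsilon> =
     \<P>(\<omega> in bandit_law (gaussian_arms \<mu> \<Delta> \<sigma>) (eps_policy \<epsilon>).
        U2 \<mu> \<Delta> \<sigma> \<epsilon> (snd \<omega>) > 0 \<bar> fst \<omega> = Arm2)"

end

theory Submission
  imports Defs "HOL-Real_Asymp.Real_Asymp"
begin

text \<open>Conditioning on arm 2 turns \<open>U\<^sub>2 > 0\<close> into the event that a Gaussian exceeds its mean by
  \<open>(1 - \<epsilon>) \<Delta>\<close>.  A shift of the density bounds this tail by
  \<open>exp (- (1 - \<epsilon>)\<^sup>2 \<Delta>\<^sup>2 / (2 \<sigma>\<^sup>2))\<close>; if \<open>\<Delta> \<le> \<sigma>\<close>, the tail contains the interval between one and two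
  standard deviations above the mean, whose mass does not depend on the parameters.\<close>

section \<open>The two-point policy and the joint law of arm and reward\<close>

lemma nn_integral_eps_policy:
  assumes "0 \<le> \<epsilon>" "\<epsilon> \<le> 1"
  shows "(\<integral>\<^sup>+a. f a \<partial>eps_policy \<epsilon>) = ennreal (1 - \<epsilon>) * f Arm1 + ennreal \<epsilon> * f Arm2"
  using assms by (simp add: eps_policy_def add.commute mult.commute)

lemma pmf_eps_policy_Arm2:
  assumes "0 \<le> \<epsilon>" "\<epsilon> \<le> 1"
  shows "pmf (eps_policy \<epsilon>) Arm2 = \<epsilon>"
proof -
  have "(\<lambda>b. if b then Arm2 else Arm1) -` {Arm2} = {True}" by (auto split: if_splits)
  with assms show ?thesis
    by (simp add: eps_policy_def pmf_map measure_pmf_single)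
qed

lemma sets_bandit_law [measurable_cong]:
  "sets (bandit_law \<nu> \<pi>) = sets (count_space UNIV \<Otimes>\<^sub>M borel)"
  unfolding bandit_law_def by (rule sets_bind) auto

text \<open>Iterated integration for the two-stage experiment. Probabilities of events and the
  policy value are both computed from it.\<close>

lemma nn_integral_bandit_law:
  assumes prob: "\<And>a. prob_space (\<nu> a)" and sets: "\<And>a. sets (\<nu> a) = sets borel"
    and f: "f \<in> borel_measurable (count_space UNIV \<Otimes>\<^sub>M borel)"
  shows "(\<integral>\<^sup>+\<omega>. f \<omega> \<partial>bandit_law \<nu> \<pi>) = (\<integral>\<^sup>+a. \<integral>\<^sup>+r. f (a, r) \<partial>\<nu> a \<partial>\<pi>)"
proof -
  let ?S = "count_space UNIV \<Otimes>\<^sub>M borel :: (arm \<times> real) measure"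
  note sets[measurable_cong]
  have m: "(\<lambda>r. (a, r)) \<in> \<nu> a \<rightarrow>\<^sub>M ?S" for a by measurable
  \<comment> \<open>Every set of arms is measurable, so the kernel is measurable once each of its
    values is a probability measure on \<open>?S\<close>.\<close>
  have k: "(\<lambda>a. distr (\<nu> a) ?S (\<lambda>r. (a, r))) \<in> measure_pmf \<pi> \<rightarrow>\<^sub>M subprob_algebra ?S"
    by (intro measurable_prob_algebraD)
       (auto simp: space_prob_algebra measurable_def intro!: prob_space.prob_space_distr prob m)
  show ?thesis
    unfolding bandit_law_def
    using f by (simp add: nn_integral_bind[OF f k] nn_integral_distr m)
qed

lemma measure_bandit_law:
  assumes prob: "\<And>a. prob_space (\<nu> a)" and sets: "\<And>a. sets (\<nu> a) = sets borel"
    and B: "B \<in> sets borel"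
  shows "measure (bandit_law \<nu> \<pi>) ({a} \<times> B) = pmf \<pi> a * measure (\<nu> a) B"
proof -
  interpret \<nu>: prob_space "\<nu> a" by (rule prob)
  have AB: "{a} \<times> B \<in> sets (count_space UNIV \<Otimes>\<^sub>M borel)"
    using B by (intro pair_measureI) auto
  have "emeasure (bandit_law \<nu> \<pi>) ({a} \<times> B)
      = (\<integral>\<^sup>+\<omega>. indicator ({a} \<times> B) \<omega> \<partial>bandit_law \<nu> \<pi>)"
    using AB by (simp add: sets_bandit_law)
  also have "\<dots> = (\<integral>\<^sup>+a'. \<integral>\<^sup>+r. indicator ({a} \<times> B) (a', r) \<partial>\<nu> a' \<partial>\<pi>)"
    using AB by (intro nn_integral_bandit_law prob sets) auto
  \<comment> \<open>The inner integral vanishes for every arm other than \<open>a\<close>.\<close>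
  also have "\<dots> = (\<integral>\<^sup>+a'. emeasure (\<nu> a) B * indicator {a} a' \<partial>\<pi>)"
  proof (intro nn_integral_cong)
    fix a'
    show "(\<integral>\<^sup>+r. indicator ({a} \<times> B) (a', r) \<partial>\<nu> a') = emeasure (\<nu> a) B * indicator {a} a'"
      using B by (cases "a' = a") (simp_all add: indicator_times sets)
  qed
  also have "\<dots> = ennreal (pmf \<pi> a * measure (\<nu> a) B)"
    by (simp add: nn_integral_cmult emeasure_pmf_single \<nu>.emeasure_eq_measure
        ennreal_mult' mult.commute)
  finally show ?thesis
    by (simp add: measure_def)
qed

text \<open>Numerator and denominator are both masses of rectangles over \<open>a\<close>, and the
  factor \<open>pmf \<pi> a\<close> cancels. The support hypothesis keeps it nonzero; otherwise the
  quotient would be 0 by convention.\<close>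

lemma cond_prob_bandit_law:
  assumes "\<And>a. prob_space (\<nu> a)" "\<And>a. sets (\<nu> a) = sets borel"
    and "{r. P r} \<in> sets borel" and "a \<in> set_pmf \<pi>"
  shows "\<P>(\<omega> in bandit_law \<nu> \<pi>. P (snd \<omega>) \<bar> fst \<omega> = a) = measure (\<nu> a) {r. P r}"
proof -
  have space: "space (bandit_law \<nu> \<pi>) = UNIV"
    using sets_eq_imp_space_eq[OF sets_bandit_law] by (simp add: space_pair_measure)
  have *: "{\<omega>. P (snd \<omega>) \<and> fst \<omega> = a} = {a} \<times> {r. P r}" "{\<omega>. fst \<omega> = a} = {a} \<times> (UNIV :: real set)"
    by auto
  have "space (\<nu> a) = UNIV"
    using sets_eq_imp_space_eq[OF assms(2)] by simp
  then have "measure (\<nu> a) UNIV = 1"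
    using prob_space.prob_space[OF assms(1)] by metis
  moreover have "pmf \<pi> a \<noteq> 0"
    using assms(4) by (simp add: set_pmf_iff)
  ultimately show ?thesis
    using assms(3) by (simp add: cond_prob_def space * measure_bandit_law assms(1,2))
qed

text \<open>The positive and negative parts of the reward are integrated separately by the
  nonnegative formula and then recombined. Integrability under each arm makes all four pieces
  finite.\<close>

lemma policy_value_eps_policy:
  assumes prob: "\<And>a. prob_space (\<nu> a)" and sets: "\<And>a. sets (\<nu> a) = sets borel"
    and int: "\<And>a. integrable (\<nu> a) (\<lambda>r. r)" and eps: "0 \<le> \<epsilon>" "\<epsilon> \<le> 1"
  shows "policy_value \<nu> (eps_policy \<epsilon>) = (1 - \<epsilon>) * (\<integral>r. r \<partial>\<nu> Arm1) + \<epsilon> * (\<integral>r. r \<partial>\<nu> Arm2)"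
proof -
  let ?M = "bandit_law \<nu> (eps_policy \<epsilon>)"
  \<comment> \<open>Since \<open>ennreal\<close> cuts negative values to 0, taking \<open>g\<close>
    as identity, \<open>uminus\<close> or \<open>norm\<close> gives the positive part, the negative
    part or the absolute value.\<close>
  have nn: "(\<integral>\<^sup>+\<omega>. ennreal (g (snd \<omega>)) \<partial>?M)
      = ennreal (1 - \<epsilon>) * (\<integral>\<^sup>+r. ennreal (g r) \<partial>\<nu> Arm1) + ennreal \<epsilon> * (\<integral>\<^sup>+r. ennreal (g r) \<partial>\<nu> Arm2)"
    if [measurable]: "g \<in> borel_measurable borel" for g :: "real \<Rightarrow> real"
    by (subst nn_integral_bandit_law[OF prob sets]) (simp_all add: nn_integral_eps_policy eps)
  have fin: "(\<integral>\<^sup>+r. ennreal (g r) \<partial>\<nu> a) < \<infinity>" if "\<And>r. g r \<le> \<bar>r\<bar>" for g a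
  proof -
    have "(\<integral>\<^sup>+r. ennreal (g r) \<partial>\<nu> a) \<le> (\<integral>\<^sup>+r. ennreal (norm r) \<partial>\<nu> a)"
      using that by (intro nn_integral_mono ennreal_leI) simp
    also have "\<dots> < \<infinity>"
      using int[of a] by (simp add: integrable_iff_bounded)
    finally show ?thesis .
  qed
  \<comment> \<open>\<open>enn2real\<close> sends infinity to 0, so linearity is claimed for finite
    values only.\<close>
  have conv: "enn2real (ennreal (1 - \<epsilon>) * x + ennreal \<epsilon> * y) = (1 - \<epsilon>) * enn2real x + \<epsilon> * enn2real y"
    if "x < \<infinity>" "y < \<infinity>" for x y :: ennreal
    using that eps
    by (cases x; cases y) (simp_all flip: ennreal_mult' ennreal_plus)
  have "integrable ?M snd"
  proof (rule integrableI_bounded)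
    show "snd \<in> borel_measurable ?M" by measurable
    show "(\<integral>\<^sup>+\<omega>. ennreal (norm (snd \<omega>)) \<partial>?M) < \<infinity>"
      using nn[of norm] fin[of norm] by (simp add: ennreal_mult_less_top)
  qed
  then have "policy_value \<nu> (eps_policy \<epsilon>)
      = enn2real (\<integral>\<^sup>+\<omega>. ennreal (snd \<omega>) \<partial>?M) - enn2real (\<integral>\<^sup>+\<omega>. ennreal (- snd \<omega>) \<partial>?M)"
    unfolding policy_value_def by (rule real_lebesgue_integral_def)
  also have "\<dots> = (1 - \<epsilon>) * (\<integral>r. r \<partial>\<nu> Arm1) + \<epsilon> * (\<integral>r. r \<partial>\<nu> Arm2)"
    using fin[of "\<lambda>r. r"] fin[of uminus]
    by (simp add: nn[of "\<lambda>r. r"] nn[of uminus] conv real_lebesgue_integral_def[OF int] abs_ge_minus_self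
        del: abs_ge_self)
       (simp add: algebra_simps)
  finally show ?thesis .
qed

section \<open>Gaussian arms: the baseline and the event of positive advantage\<close>

lemma prob_space_gaussian_arms:
  assumes "0 < \<sigma>"
  shows "prob_space (gaussian_arms \<mu> \<Delta> \<sigma> a)"
  using assms by (cases a) (simp_all add: prob_space_return prob_space_normal_density)

lemma sets_gaussian_arms: "sets (gaussian_arms \<mu> \<Delta> \<sigma> a) = sets borel"
  by (cases a) simp_all

lemma integrable_gaussian_arms:
  assumes "0 < \<sigma>"
  shows "integrable (gaussian_arms \<mu> \<Delta> \<sigma> a) (\<lambda>r. r)"
  using integrable_normal_moment_nz_1[OF assms, of "\<mu> - \<Delta>"]
  by (cases a) (auto simp: integrable_real_density nn_integral_return intro!: integrableI_bounded)

lemma policy_value_gaussian_arms: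
  assumes "0 < \<sigma>" "0 \<le> \<epsilon>" "\<epsilon> \<le> 1"
  shows "policy_value (gaussian_arms \<mu> \<Delta> \<sigma>) (eps_policy \<epsilon>) = \<mu> - \<epsilon> * \<Delta>"
proof -
  have "(\<integral>r. r \<partial>gaussian_arms \<mu> \<Delta> \<sigma> Arm2) = \<mu> - \<Delta>"
    using integral_normal_moment_nz_1[OF assms(1), of "\<mu> - \<Delta>"]
    by (simp add: integral_real_density)
  moreover have "(\<integral>r. r \<partial>gaussian_arms \<mu> \<Delta> \<sigma> Arm1) = \<mu>"
    by (simp add: integral_return)
  moreover have "policy_value (gaussian_arms \<mu> \<Delta> \<sigma>) (eps_policy \<epsilon>) =
      (1 - \<epsilon>) * (\<integral>r. r \<partial>gaussian_arms \<mu> \<Delta> \<sigma> Arm1) + \<epsilon> * (\<integral>r. r \<partial>gaussian_arms \<mu> \<Delta> \<sigma> Arm2)"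
    using assms
    by (intro policy_value_eps_policy prob_space_gaussian_arms sets_gaussian_arms
        integrable_gaussian_arms)
  ultimately show ?thesis
    by (simp only:) (simp add: algebra_simps)
qed

lemma prob_pos_advantage_eq:
  assumes "0 < \<sigma>" "0 < \<epsilon>" "\<epsilon> < 1"
  shows "prob_pos_advantage \<mu> \<Delta> \<sigma> \<epsilon>
    = measure (density lborel (normal_density (\<mu> - \<Delta>) \<sigma>)) {\<mu> - \<Delta> + (1 - \<epsilon>) * \<Delta><..}"
proof -
  have "Arm2 \<in> set_pmf (eps_policy \<epsilon>)"
    using assms by (simp add: set_pmf_iff pmf_eps_policy_Arm2)
  \<comment> \<open>The threshold \<open>\<mu> - \<epsilon> * \<Delta>\<close> is rewritten as the
    mean of arm 2 plus a margin, the shape of the tail bounds below.\<close>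
  moreover have "{r. U2 \<mu> \<Delta> \<sigma> \<epsilon> r > 0} = {\<mu> - \<Delta> + (1 - \<epsilon>) * \<Delta><..}"
    using assms by (auto simp: advantage_def policy_value_gaussian_arms algebra_simps)
  ultimately show ?thesis
    unfolding prob_pos_advantage_def
    using cond_prob_bandit_law[OF prob_space_gaussian_arms[OF assms(1)] sets_gaussian_arms,
        where P = "\<lambda>r. U2 \<mu> \<Delta> \<sigma> \<epsilon> r > 0" and a = Arm2]
    by simp
qed

section \<open>Gaussian tail bounds\<close>

text \<open>On the tail \<open>{m + d<..}\<close> the density is dominated by \<open>exp (-d\<^sup>2 / (2 \<sigma>\<^sup>2))\<close> times
  the density recentred at \<open>m + d\<close>, because \<open>x\<^sup>2 \<ge> d\<^sup>2 + (x - d)\<^sup>2\<close> for \<open>x \<ge> d \<ge> 0\<close>.\<close>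

lemma normal_tail_upper:
  assumes "0 < \<sigma>" "0 \<le> d"
  shows "measure (density lborel (normal_density m \<sigma>)) {m + d<..} \<le> exp (- (d\<^sup>2 / (2 * \<sigma>\<^sup>2)))"
proof -
  let ?e = "exp (- (d\<^sup>2 / (2 * \<sigma>\<^sup>2)))"
  have dens: "normal_density m \<sigma> x \<le> ?e * normal_density (m + d) \<sigma> x" if "m + d < x" for x
  proof -
    \<comment> \<open>Twice this product is the difference between the two sides of the next
      inequality.\<close>
    have "0 \<le> d * (x - m - d)"
      using assms that by (intro mult_nonneg_nonneg) auto
    then have "d\<^sup>2 + (x - (m + d))\<^sup>2 \<le> (x - m)\<^sup>2"
      by (simp add: power2_eq_square algebra_simps)
    then have "(d\<^sup>2 + (x - (m + d))\<^sup>2) / (2 * \<sigma>\<^sup>2) \<le> (x - m)\<^sup>2 / (2 * \<sigma>\<^sup>2)"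
      by (rule divide_right_mono) simp
    then have "exp (- (x - m)\<^sup>2 / (2 * \<sigma>\<^sup>2)) \<le> ?e * exp (- (x - (m + d))\<^sup>2 / (2 * \<sigma>\<^sup>2))"
      by (simp add: add_divide_distrib flip: exp_add)
    then show ?thesis
      using assms by (simp add: normal_density_def divide_right_mono)
  qed
  have "emeasure (density lborel (normal_density m \<sigma>)) {m + d<..}
      = (\<integral>\<^sup>+x. ennreal (normal_density m \<sigma> x) * indicator {m + d<..} x \<partial>lborel)"
    by (simp add: emeasure_density)
  also have "\<dots> \<le> (\<integral>\<^sup>+x. ennreal ?e * ennreal (normal_density (m + d) \<sigma> x) \<partial>lborel)"
    using dens by (intro nn_integral_mono)
      (auto simp: indicator_def ennreal_leI simp flip: ennreal_mult')
  also have "\<dots> = ennreal ?e"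
    using assms by (simp add: nn_integral_cmult nn_integral_eq_integral)
  finally show ?thesis
    by (simp add: measure_def enn2real_leI)
qed

lemma normal_tail_lower:
  assumes "0 < \<sigma>" "d \<le> \<sigma>"
  shows "exp (- 2) / sqrt (2 * pi) \<le> measure (density lborel (normal_density m \<sigma>)) {m + d<..}"
proof -
  interpret prob_space "density lborel (normal_density m \<sigma>)"
    using assms(1) by (rule prob_space_normal_density)
  \<comment> \<open>This is the density two standard deviations above the mean, its minimum on the
    interval used. Multiplying by the length \<open>\<sigma>\<close> of that interval cancels
    \<open>\<sigma>\<close>.\<close>
  let ?b = "exp (- 2) / sqrt (2 * pi * \<sigma>\<^sup>2)"
  have dens: "?b \<le> normal_density m \<sigma> x" if "m + \<sigma> < x" "x \<le> m + 2 * \<sigma>" for x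
  proof -
    have "(x - m)\<^sup>2 \<le> (2 * \<sigma>)\<^sup>2"
      using that assms by (intro power_mono) auto
    then have "(x - m)\<^sup>2 / (2 * \<sigma>\<^sup>2) \<le> 2"
      using assms by (simp add: divide_le_eq power2_eq_square)
    then show ?thesis
      by (simp add: normal_density_def divide_right_mono)
  qed
  have "ennreal (exp (- 2) / sqrt (2 * pi)) = ennreal ?b * emeasure lborel {m + \<sigma><..m + 2 * \<sigma>}"
    using assms by (simp add: real_sqrt_mult flip: ennreal_mult')
  also have "\<dots> = (\<integral>\<^sup>+x. ennreal ?b * indicator {m + \<sigma><..m + 2 * \<sigma>} x \<partial>lborel)"
    by (simp add: nn_integral_cmult_indicator)
  also have "\<dots> \<le> (\<integral>\<^sup>+x. ennreal (normal_density m \<sigma> x) * indicator {m + d<..} x \<partial>lborel)"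
    using dens assms by (intro nn_integral_mono) (auto simp: indicator_def ennreal_leI)
  also have "\<dots> = emeasure (density lborel (normal_density m \<sigma>)) {m + d<..}"
    by (simp add: emeasure_density)
  finally show ?thesis
    by (simp add: emeasure_eq_measure)
qed

section \<open>Growth of delight as \<epsilon> tends to 0\<close>

lemma abs_delight_eps_policy:
  assumes "0 < \<epsilon>" "\<epsilon> < 1"
  shows "\<bar>delight (eps_policy \<epsilon>) Arm2 u\<bar> = \<bar>u\<bar> * - ln \<epsilon>"
  using assms by (simp add: delight_def surprisal_def pmf_eps_policy_Arm2 abs_mult)

lemma eventually_at_right_0_less_1: "eventually (\<lambda>\<epsilon> :: real. \<epsilon> \<in> {0<..<1}) (at_right 0)"
  by (rule eventually_at_right_real) simp

text \<open>The surprisal diverges while the other factor keeps a nonzero limit. The advantage may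
  vary with \<epsilon> because the baseline does.\<close>

lemma filterlim_abs_delight_eps_policy:
  assumes "(u \<longlongrightarrow> a) (at_right 0)" "a \<noteq> 0"
  shows "filterlim (\<lambda>\<epsilon>. \<bar>delight (eps_policy \<epsilon>) Arm2 (u \<epsilon>)\<bar>) at_top (at_right 0)"
proof -
  have "filterlim (\<lambda>\<epsilon> :: real. - ln \<epsilon>) at_top (at_right 0)"
    by real_asymp
  then have "filterlim (\<lambda>\<epsilon>. \<bar>u \<epsilon>\<bar> * - ln \<epsilon>) at_top (at_right 0)"
    using assms by (intro filterlim_tendsto_pos_mult_at_top[OF tendsto_rabs]) auto
  moreover have "\<forall>\<^sub>F \<epsilon> in at_right 0.
      \<bar>delight (eps_policy \<epsilon>) Arm2 (u \<epsilon>)\<bar> = \<bar>u \<epsilon>\<bar> * - ln \<epsilon>"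
    using eventually_at_right_0_less_1 by eventually_elim (simp add: abs_delight_eps_policy)
  ultimately show ?thesis
    by (subst filterlim_cong[OF refl refl])
qed

text \<open>If \<open>a < 0\<close>, both factors decrease near \<open>0\<close>.  If \<open>a > 0\<close>, the first factor increases,
  but \<open>a (ln y - ln x) \<ge> a (y - x) / y\<close> outweighs its contribution
  \<open>\<Delta> (y - x) (- ln y)\<close> as soon as \<open>a > - \<Delta> y ln y\<close>.\<close>

lemma eventually_strict_antimono_perturbed_log:
  fixes a \<Delta> :: real
  assumes "a \<noteq> 0" "0 < \<Delta>"
  shows "\<exists>\<epsilon>0>0. \<epsilon>0 \<le> 1 \<and> strict_antimono_on {0<..<\<epsilon>0} (\<lambda>\<epsilon>. \<bar>a + \<epsilon> * \<Delta>\<bar> * - ln \<epsilon>)"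
proof -
  have "((\<lambda>y. \<Delta> * (- y * ln y)) \<longlongrightarrow> 0) (at_right 0)"
    by real_asymp
  then have "\<forall>\<^sub>F y in at_right 0. \<Delta> * (- y * ln y) < \<bar>a\<bar>"
    using assms by (intro order_tendstoD) auto
  \<comment> \<open>For negative \<open>a\<close> this keeps \<open>a + y * \<Delta>\<close> below
    0, so that its absolute value decreases in \<open>y\<close>.\<close>
  moreover have "((\<lambda>y. y * \<Delta>) \<longlongrightarrow> 0) (at_right 0)"
    by real_asymp
  then have "\<forall>\<^sub>F y in at_right 0. y * \<Delta> < \<bar>a\<bar>"
    using assms by (intro order_tendstoD) auto
  ultimately have "\<forall>\<^sub>F y in at_right 0. \<Delta> * (- y * ln y) < \<bar>a\<bar> \<and> y * \<Delta> < \<bar>a\<bar> \<and> y < 1"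
    using eventually_at_right_0_less_1 by eventually_elim auto
  then obtain b where b: "0 < b"
      "\<And>y. 0 < y \<Longrightarrow> y < b \<Longrightarrow> \<Delta> * (- y * ln y) < \<bar>a\<bar> \<and> y * \<Delta> < \<bar>a\<bar> \<and> y < 1"
    unfolding eventually_at_right_field by auto
  have "strict_antimono_on {0<..<min b 1} (\<lambda>\<epsilon>. \<bar>a + \<epsilon> * \<Delta>\<bar> * - ln \<epsilon>)"
  proof (rule monotone_onI)
    fix x y :: real
    assume "x \<in> {0<..<min b 1}" "y \<in> {0<..<min b 1}" and xy: "x < y"
    then have x: "0 < x" "x < 1" "x * \<Delta> < \<bar>a\<bar>"
      and y: "0 < y" "y < 1" "y * \<Delta> < \<bar>a\<bar>" "\<Delta> * (- y * ln y) < \<bar>a\<bar>"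
      using b(2)[of x] b(2)[of y] by auto
    show "\<bar>a + y * \<Delta>\<bar> * - ln y < \<bar>a + x * \<Delta>\<bar> * - ln x"
    proof (cases "a > 0")
      case True
      \<comment> \<open>The inequality \<open>ln t \<le> t - 1\<close> at
        \<open>t = x / y\<close>.\<close>
      have "1 - x / y \<le> - ln (x / y)"
        using ln_le_minus_one[of "x / y"] x y by simp
      then have ln: "(y - x) / y \<le> ln y - ln x"
        using x y by (simp add: ln_div diff_divide_distrib)
      have "(y - x) / y * (\<Delta> * (- y * ln y)) < (y - x) / y * a"
        using True xy y by (intro mult_strict_left_mono) auto
      moreover have "(y - x) / y * (\<Delta> * (- y * ln y)) = \<Delta> * (y - x) * - ln y"
        using y by simp
      ultimately have "\<Delta> * (y - x) * - ln y < (y - x) / y * a"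
        by simp
      also have "\<dots> \<le> (ln y - ln x) * a"
        using ln True by (intro mult_right_mono) auto
      \<comment> \<open>The added nonnegative term is the one that appears when the difference of
        the two products is expanded.\<close>
      also have "\<dots> \<le> (ln y - ln x) * a + \<Delta> * x * (ln y - ln x)"
        using x xy assms by simp
      finally have "(a + y * \<Delta>) * - ln y < (a + x * \<Delta>) * - ln x"
        by (simp add: algebra_simps)
      moreover have "0 < a + x * \<Delta>" "0 < a + y * \<Delta>"
        using True x y assms by (simp_all add: add_pos_pos)
      ultimately show ?thesis by simp
    next
      case False
      have "x * \<Delta> < y * \<Delta>" using xy assms by simp
      with False x y have "\<bar>a + y * \<Delta>\<bar> < \<bar>a + x * \<Delta>\<bar>" by linarith
      then show ?thesis
        using x y xy by (intro mult_strict_mono) auto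
    qed
  qed
  with b(1) show ?thesis
    by (intro exI[of _ "min b 1"]) auto
qed

text \<open>The only exceptional reward is \<open>r = \<mu>\<close>: there the advantage is
  \<open>\<epsilon> * \<Delta>\<close>, which beats the logarithm and drives the delight to 0. A
  single point is null for the Gaussian. The interval of monotonicity depends on
  \<open>r\<close>.\<close>

lemma AE_chi2_diverges:
  assumes "0 < \<Delta>" "0 < \<sigma>"
  shows "AE r in gaussian_arms \<mu> \<Delta> \<sigma> Arm2.
      (\<exists>\<epsilon>0 > 0. strict_antimono_on {0<..<\<epsilon>0} (\<lambda>\<epsilon>. \<bar>chi2 \<mu> \<Delta> \<sigma> \<epsilon> r\<bar>))
    \<and> filterlim (\<lambda>\<epsilon>. \<bar>chi2 \<mu> \<Delta> \<sigma> \<epsilon> r\<bar>) at_top (at_right 0)"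
proof -
  have "AE r in gaussian_arms \<mu> \<Delta> \<sigma> Arm2. r \<noteq> \<mu>"
    unfolding gaussian_arms.simps
    by (subst AE_density) (use AE_lborel_singleton[of \<mu>] in \<open>auto elim: eventually_mono\<close>)
  then show ?thesis
  proof eventually_elim
    case (elim r)
    have U2: "U2 \<mu> \<Delta> \<sigma> \<epsilon> r = r - \<mu> + \<epsilon> * \<Delta>" if "\<epsilon> \<in> {0<..<1}" for \<epsilon>
      using that assms by (simp add: advantage_def policy_value_gaussian_arms)
    from elim obtain b where b: "0 < b" "b \<le> 1"
        "strict_antimono_on {0<..<b} (\<lambda>\<epsilon>. \<bar>r - \<mu> + \<epsilon> * \<Delta>\<bar> * - ln \<epsilon>)"
      using eventually_strict_antimono_perturbed_log[of "r - \<mu>" \<Delta>] assms by auto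
    have "strict_antimono_on {0<..<b} (\<lambda>\<epsilon>. \<bar>chi2 \<mu> \<Delta> \<sigma> \<epsilon> r\<bar>)"
    proof (rule monotone_onI)
      fix x y assume "x \<in> {0<..<b}" "y \<in> {0<..<b}" "x < y"
      with monotone_onD[OF b(3), of x y] b(2) show "\<bar>chi2 \<mu> \<Delta> \<sigma> y r\<bar> < \<bar>chi2 \<mu> \<Delta> \<sigma> x r\<bar>"
        by (simp add: abs_delight_eps_policy U2)
    qed
    moreover have "((\<lambda>\<epsilon>. U2 \<mu> \<Delta> \<sigma> \<epsilon> r) \<longlongrightarrow> r - \<mu>) (at_right 0)"
    proof (rule tendsto_cong[THEN iffD2])
      show "\<forall>\<^sub>F \<epsilon> in at_right 0. U2 \<mu> \<Delta> \<sigma> \<epsilon> r = r - \<mu> + \<epsilon> * \<Delta>"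
        using eventually_at_right_0_less_1 by eventually_elim (rule U2)
      show "((\<lambda>\<epsilon>. r - \<mu> + \<epsilon> * \<Delta>) \<longlongrightarrow> r - \<mu>) (at_right 0)"
        by (auto intro!: tendsto_eq_intros)
    qed
    ultimately show ?case
      using b(1) elim by (auto intro!: filterlim_abs_delight_eps_policy)
  qed
qed

section \<open>Uniform bounds on the probability of positive advantage, and the final
  assembly\<close>

text \<open>The margin \<open>(1 - \<epsilon>) * \<Delta>\<close> shrinks to 0 as \<epsilon>
  approaches 1, where the probability tends to one half. Bounding \<epsilon> by
  \<open>\<epsilon>0\<close> gives a rate common to all admissible \<epsilon>.\<close>

lemma prob_pos_advantage_upper:
  assumes "0 < \<Delta>" "0 < \<sigma>" "0 < \<epsilon>" "\<epsilon> \<le> \<epsilon>0" "\<epsilon>0 < 1"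
  shows "prob_pos_advantage \<mu> \<Delta> \<sigma> \<epsilon> \<le> exp (- ((1 - \<epsilon>0)\<^sup>2 / 2 * (\<Delta>\<^sup>2 / \<sigma>\<^sup>2)))"
proof -
  have "prob_pos_advantage \<mu> \<Delta> \<sigma> \<epsilon> \<le> exp (- (((1 - \<epsilon>) * \<Delta>)\<^sup>2 / (2 * \<sigma>\<^sup>2)))"
    using assms by (simp add: prob_pos_advantage_eq normal_tail_upper)
  also have "((1 - \<epsilon>0) * \<Delta>)\<^sup>2 / (2 * \<sigma>\<^sup>2) \<le> ((1 - \<epsilon>) * \<Delta>)\<^sup>2 / (2 * \<sigma>\<^sup>2)"
    using assms by (intro divide_right_mono power_mono mult_right_mono) auto
  then have "exp (- (((1 - \<epsilon>) * \<Delta>)\<^sup>2 / (2 * \<sigma>\<^sup>2))) \<le> exp (- ((1 - \<epsilon>0)\<^sup>2 / 2 * (\<Delta>\<^sup>2 / \<sigma>\<^sup>2)))"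
    by (simp add: power_mult_distrib)
  finally show ?thesis .
qed

lemma prob_pos_advantage_lower:
  assumes "0 < \<Delta>" "\<Delta> \<le> \<sigma>" "0 < \<epsilon>" "\<epsilon> < 1"
  shows "exp (- 2) / sqrt (2 * pi) \<le> prob_pos_advantage \<mu> \<Delta> \<sigma> \<epsilon>"
proof -
  \<comment> \<open>The margin stays within one standard deviation for every \<epsilon>, so the
    constant is uniform.\<close>
  have "(1 - \<epsilon>) * \<Delta> \<le> 1 * \<sigma>"
    using assms by (intro mult_mono) auto
  then show ?thesis
    using assms by (subst prob_pos_advantage_eq) (auto intro!: normal_tail_lower)
qed

lemma prob_pos_advantage_le_1:
  assumes "0 < \<sigma>" "0 < \<epsilon>" "\<epsilon> < 1"
  shows "prob_pos_advantage \<mu> \<Delta> \<sigma> \<epsilon> \<le> 1"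
  using assms by (simp add: prob_pos_advantage_eq prob_space.prob_le_1 prob_space_normal_density)

text \<open>The constants are chosen before \<mu>, \<Delta>, \<sigma> and \<epsilon>, which makes
  the asymptotic bounds uniform. Growth of delight is stated twice: for a fixed reward, whose
  advantage moves with the baseline, and for a fixed advantage, where surprisal alone acts.\<close>

theorem proposition3:
  shows
    "(\<forall>\<mu> \<Delta> \<sigma> \<epsilon> :: real. 0 < \<Delta> \<and> 0 < \<sigma> \<and> 0 < \<epsilon> \<and> \<epsilon> < 1 \<longrightarrow>
        policy_value (gaussian_arms \<mu> \<Delta> \<sigma>) (eps_policy \<epsilon>) = \<mu> - \<epsilon> * \<Delta>)
   \<and> (\<forall>\<epsilon>0 :: real. 0 < \<epsilon>0 \<and> \<epsilon>0 < 1 \<longrightarrow>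
        (\<exists>c > 0. \<exists>\<delta> > 0. \<forall>\<mu> \<Delta> \<sigma> \<epsilon> :: real.
           0 < \<Delta> \<and> 0 < \<sigma> \<and> 0 < \<epsilon> \<and> \<epsilon> \<le> \<epsilon>0 \<and> \<sigma> / \<Delta> < \<delta> \<longrightarrow>
           prob_pos_advantage \<mu> \<Delta> \<sigma> \<epsilon> \<le> exp (- (c * (\<Delta>\<^sup>2 / \<sigma>\<^sup>2)))))
   \<and> (\<exists>c > 0. \<exists>C > 0. \<exists>K > 0. \<forall>\<mu> \<Delta> \<sigma> \<epsilon> :: real.
        0 < \<Delta> \<and> 0 < \<sigma> \<and> 0 < \<epsilon> \<and> \<epsilon> < 1 \<and> \<sigma> / \<Delta> > K \<longrightarrow>
        c \<le> prob_pos_advantage \<mu> \<Delta> \<sigma> \<epsilon> \<and> prob_pos_advantage \<mu> \<Delta> \<sigma> \<epsilon> \<le> C)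
   \<and> (\<forall>\<mu> \<Delta> \<sigma> :: real. 0 < \<Delta> \<and> 0 < \<sigma> \<longrightarrow>
        (\<forall>\<epsilon> r. 0 < \<epsilon> \<and> \<epsilon> < 1 \<longrightarrow>
           \<bar>chi2 \<mu> \<Delta> \<sigma> \<epsilon> r\<bar> = \<bar>U2 \<mu> \<Delta> \<sigma> \<epsilon> r\<bar> * ln (1 / \<epsilon>))
      \<and> (AE r in gaussian_arms \<mu> \<Delta> \<sigma> Arm2.
           (\<exists>\<epsilon>0 > 0. strict_antimono_on {0<..<\<epsilon>0} (\<lambda>\<epsilon>. \<bar>chi2 \<mu> \<Delta> \<sigma> \<epsilon> r\<bar>))
         \<and> filterlim (\<lambda>\<epsilon>. \<bar>chi2 \<mu> \<Delta> \<sigma> \<epsilon> r\<bar>) at_top (at_right 0)))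
   \<and> (\<forall>u :: real. u \<noteq> 0 \<longrightarrow>
        strict_antimono_on {0<..<1} (\<lambda>\<epsilon>. \<bar>delight (eps_policy \<epsilon>) Arm2 u\<bar>)
      \<and> filterlim (\<lambda>\<epsilon>. \<bar>delight (eps_policy \<epsilon>) Arm2 u\<bar>) at_top (at_right 0))"
proof (intro conjI)
  show "\<forall>\<mu> \<Delta> \<sigma> \<epsilon> :: real. 0 < \<Delta> \<and> 0 < \<sigma> \<and> 0 < \<epsilon> \<and> \<epsilon> < 1 \<longrightarrow>
      policy_value (gaussian_arms \<mu> \<Delta> \<sigma>) (eps_policy \<epsilon>) = \<mu> - \<epsilon> * \<Delta>"
    by (simp add: policy_value_gaussian_arms)
next
  show "\<forall>\<epsilon>0 :: real. 0 < \<epsilon>0 \<and> \<epsilon>0 < 1 \<longrightarrow>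
      (\<exists>c > 0. \<exists>\<delta> > 0. \<forall>\<mu> \<Delta> \<sigma> \<epsilon> :: real.
         0 < \<Delta> \<and> 0 < \<sigma> \<and> 0 < \<epsilon> \<and> \<epsilon> \<le> \<epsilon>0 \<and> \<sigma> / \<Delta> < \<delta> \<longrightarrow>
         prob_pos_advantage \<mu> \<Delta> \<sigma> \<epsilon> \<le> exp (- (c * (\<Delta>\<^sup>2 / \<sigma>\<^sup>2))))"
  proof (intro allI impI)
    fix \<epsilon>0 :: real assume "0 < \<epsilon>0 \<and> \<epsilon>0 < 1"
    then show "\<exists>c > 0. \<exists>\<delta> > 0. \<forall>\<mu> \<Delta> \<sigma> \<epsilon> :: real.
         0 < \<Delta> \<and> 0 < \<sigma> \<and> 0 < \<epsilon> \<and> \<epsilon> \<le> \<epsilon>0 \<and> \<sigma> / \<Delta> < \<delta> \<longrightarrow>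
         prob_pos_advantage \<mu> \<Delta> \<sigma> \<epsilon> \<le> exp (- (c * (\<Delta>\<^sup>2 / \<sigma>\<^sup>2)))"
      using prob_pos_advantage_upper
      \<comment> \<open>The rate is the Gaussian exponent at the smallest margin, attained at
        \<open>\<epsilon>0\<close>.\<close>
      by (intro exI[of _ "(1 - \<epsilon>0)\<^sup>2 / 2"] conjI exI[of _ "1 :: real"]) auto
  qed
next
  show "\<exists>c > 0. \<exists>C > 0. \<exists>K > 0. \<forall>\<mu> \<Delta> \<sigma> \<epsilon> :: real.
      0 < \<Delta> \<and> 0 < \<sigma> \<and> 0 < \<epsilon> \<and> \<epsilon> < 1 \<and> \<sigma> / \<Delta> > K \<longrightarrow>
      c \<le> prob_pos_advantage \<mu> \<Delta> \<sigma> \<epsilon> \<and> prob_pos_advantage \<mu> \<Delta> \<sigma> \<epsilon> \<le> C"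
    \<comment> \<open>With \<open>K = 1\<close> the noise exceeds the gap, as the lower tail bound
      requires; \<open>C = 1\<close> bounds any probability.\<close>
    by (intro exI[of _ "exp (- 2) / sqrt (2 * pi)"] conjI exI[of _ "1 :: real"])
       (auto intro!: prob_pos_advantage_lower prob_pos_advantage_le_1)
next
  show "\<forall>\<mu> \<Delta> \<sigma> :: real. 0 < \<Delta> \<and> 0 < \<sigma> \<longrightarrow>
        (\<forall>\<epsilon> r. 0 < \<epsilon> \<and> \<epsilon> < 1 \<longrightarrow>
           \<bar>chi2 \<mu> \<Delta> \<sigma> \<epsilon> r\<bar> = \<bar>U2 \<mu> \<Delta> \<sigma> \<epsilon> r\<bar> * ln (1 / \<epsilon>))
      \<and> (AE r in gaussian_arms \<mu> \<Delta> \<sigma> Arm2.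
           (\<exists>\<epsilon>0 > 0. strict_antimono_on {0<..<\<epsilon>0} (\<lambda>\<epsilon>. \<bar>chi2 \<mu> \<Delta> \<sigma> \<epsilon> r\<bar>))
         \<and> filterlim (\<lambda>\<epsilon>. \<bar>chi2 \<mu> \<Delta> \<sigma> \<epsilon> r\<bar>) at_top (at_right 0))"
  proof (intro allI impI conjI[OF _ AE_chi2_diverges])
    fix \<mu> \<Delta> \<sigma> \<epsilon> r :: real
    assume "0 < \<epsilon> \<and> \<epsilon> < 1"
    then show "\<bar>chi2 \<mu> \<Delta> \<sigma> \<epsilon> r\<bar> = \<bar>U2 \<mu> \<Delta> \<sigma> \<epsilon> r\<bar> * ln (1 / \<epsilon>)"
      by (simp add: abs_delight_eps_policy ln_div)
  qed auto
next
  show "\<forall>u :: real. u \<noteq> 0 \<longrightarrow>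
        strict_antimono_on {0<..<1} (\<lambda>\<epsilon>. \<bar>delight (eps_policy \<epsilon>) Arm2 u\<bar>)
      \<and> filterlim (\<lambda>\<epsilon>. \<bar>delight (eps_policy \<epsilon>) Arm2 u\<bar>) at_top (at_right 0)"
    using filterlim_abs_delight_eps_policy[OF tendsto_const]
    by (auto intro!: monotone_onI simp: abs_delight_eps_policy)
qed

end
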